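(* Let $d,\nu\ge 1$ be integers, let $S\subset\{0,1\}^{\Lambda_\nu}$ be a parking scheme, and let $P$ be the corresponding limit algorithm. For $x\in\mathbb{Z}^d$ let $\sigma_{0x}=\dfrac{\mathrm{Cov}(P(0),P(x))}{\sqrt{\mathrm{Var}(P(0))}\sqrt{\mathrm{Var}(P(x))}}$ be the correlation coefficient of the random variables $P(0)$ and $P(x)$. Then $\sigma_{0x}$ decays super-exponentially as $x\to\infty$, i.e. for every $\alpha>0$, $\lim_{|x|_{\sup}\to\infty}\sigma_{0x}\,e^{\alpha|x|_{\sup}}=0$.
   Context: Probability space: $\Omega=(0,1)^{\mathbb{Z}^d}$ with product Borel $\sigma$-algebra and the product $\lambda_{(0,1)}^{\mathbb{Z}^d}$ of Lebesgue measures on $(0,1)$; variances and covariances are under this measure. $|x|_{\sup}=\max_i|x_i|$; $\Lambda_n=\{-n,\dots,n\}^d$. Parking scheme: a subset $S\subset\{0,1\}^{\Lambda_\nu}$ containing the all-zero configuration; $\nu$ is its radius of interaction. Translation: $\theta_x(\eta)(z)=\eta(z+x)$. Parking process on a finite set $X\subset\mathbb{Z}^d$ with null boundary condition: for $\omega\in\Omega$ with pairwise distinct coordinates, start with $\eta=0^{\mathbb{Z}^d}$ and visit the sites of $X$ once each, in increasing order of the values $\omega(x)$; when visiting $x$, if the current configuration $\eta$ satisfies $\theta_x(\eta)|_{\Lambda_\nu}\in S$, then set $\eta(x)=1$, otherwise leave $\eta$ unchanged. The final configuration is denoted $P_X(\omega)\in\{0,1\}^{\mathbb{Z}^d}$ (the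 jamming limit). Armour: a path is a finite sequence $(x_i)_{0\le i\le m}$ in $\mathbb{Z}^d$ ($m\ge 0$) with $|x_{i+1}-x_i|_{\sup}\le\nu$ for all $i$; it is decreasing (for $\omega$) if $\omega(x_0)>\omega(x_1)>\dots>\omega(x_m)$. Write $y\uparrow_{(\omega)}x$ if there is a decreasing path from $x_0=x$ to $x_m=y$ (so $x\uparrow_{(\omega)}x$). The armour of $X\subset\mathbb{Z}^d$ is $\mathcal{A}(X)(\omega)=\{y\in\mathbb{Z}^d:\exists x\in X,\ y\uparrow_{(\omega)}x\}$. For finite $X$ it is almost surely finite. Limit algorithm: $P(\omega)(x)=P_{\mathcal{A}(\{x\})(\omega)}(\omega)(x)$ for all $x\in\mathbb{Z}^d$. Convention: on the exceptional null set of $\omega$ having two equal coordinates, or for which an infinite decreasing path exists, set $P(\omega)=0^{\mathbb{Z}^d}$. *)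

theory Defs
  imports "HOL-Probability.Probability"
begin

text \<open>
  The lattice is \<open>int ^ 'd\<close> with \<open>'d\<close> an arbitrary finite index type, so the dimension is
  \<open>CARD('d)\<close>, which is at least 1 because types are nonempty.
\<close>

type_synonym 'd site = "int ^ 'd"
type_synonym 'd config = "'d site \<Rightarrow> nat"
type_synonym 'd clocks = "'d site \<Rightarrow> real"

definition sup_norm :: "'d::finite site \<Rightarrow> int"
  where "sup_norm x = Max (range (\<lambda>i. \<bar>x $ i\<bar>))"

definition box :: "nat \<Rightarrow> 'd::finite site set"
  where "box n = {x. \<forall>i. - int n \<le> x $ i \<and> x $ i \<le> int n}"

definition Omega :: "'d::finite clocks measure"
  where "Omega = (\<Pi>\<^sub>M x\<in>UNIV. restrict_space lborel {0<..<1})"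

text \<open>A configuration on \<open>box \<nu>\<close> is an extensional function from \<open>box \<nu>\<close> to \<open>{0, 1}\<close>.\<close>

definition parking_scheme :: "nat \<Rightarrow> 'd::finite config set \<Rightarrow> bool"
  where "parking_scheme \<nu> S \<longleftrightarrow>
    S \<subseteq> (box \<nu> \<rightarrow>\<^sub>E {0, 1}) \<and> restrict (\<lambda>_. 0) (box \<nu>) \<in> S"

definition translate :: "'d::finite site \<Rightarrow> 'd config \<Rightarrow> 'd config"
  where "translate x \<eta> = (\<lambda>z. \<eta> (z + x))"

definition park_step :: "nat \<Rightarrow> 'd::finite config set \<Rightarrow> 'd site \<Rightarrow> 'd config \<Rightarrow> 'd config"
  where "park_step \<nu> S x \<eta> =
    (if restrict (translate x \<eta>) (box \<nu>) \<in> S then \<eta>(x := 1) else \<eta>)"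

text \<open>
  The jamming limit on \<open>X\<close> with null boundary condition. It is meaningful when \<open>X\<close> is finite and
  \<open>\<omega>\<close> is injective on \<open>X\<close>: then \<open>sorted_key_list_of_set \<omega> X\<close> lists each site of \<open>X\<close> once, by
  increasing value of \<open>\<omega>\<close>.
\<close>

definition jamming_limit ::
    "nat \<Rightarrow> 'd::finite config set \<Rightarrow> 'd site set \<Rightarrow> 'd clocks \<Rightarrow> 'd config"
  where "jamming_limit \<nu> S X \<omega> =
    fold (park_step \<nu> S) (sorted_key_list_of_set \<omega> X) (\<lambda>_. 0)"

definition is_path :: "nat \<Rightarrow> 'd::finite site list \<Rightarrow> bool"
  where "is_path \<nu> xs \<longleftrightarrow>
    xs \<noteq> [] \<and> successively (\<lambda>x y. sup_norm (y - x) \<le> int \<nu>) xs"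

definition decreasing :: "'d::finite clocks \<Rightarrow> 'd site list \<Rightarrow> bool"
  where "decreasing \<omega> xs \<longleftrightarrow> successively (\<lambda>x y. \<omega> x > \<omega> y) xs"

text \<open>\<open>leads_up \<nu> \<omega> y x\<close>: a decreasing path starts at \<open>x\<close> and ends at \<open>y\<close>.\<close>

definition leads_up :: "nat \<Rightarrow> 'd::finite clocks \<Rightarrow> 'd site \<Rightarrow> 'd site \<Rightarrow> bool"
  where "leads_up \<nu> \<omega> y x \<longleftrightarrow>
    (\<exists>xs. is_path \<nu> xs \<and> decreasing \<omega> xs \<and> hd xs = x \<and> last xs = y)"

definition armour :: "nat \<Rightarrow> 'd::finite site set \<Rightarrow> 'd clocks \<Rightarrow> 'd site set"
  where "armour \<nu> X \<omega> = {y. \<exists>x\<in>X. leads_up \<nu> \<omega> y x}"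

definition infinite_decreasing_path :: "nat \<Rightarrow> 'd::finite clocks \<Rightarrow> (nat \<Rightarrow> 'd site) \<Rightarrow> bool"
  where "infinite_decreasing_path \<nu> \<omega> p \<longleftrightarrow>
    (\<forall>i. sup_norm (p (Suc i) - p i) \<le> int \<nu> \<and> \<omega> (p i) > \<omega> (p (Suc i)))"

definition exceptional :: "nat \<Rightarrow> 'd::finite clocks \<Rightarrow> bool"
  where "exceptional \<nu> \<omega> \<longleftrightarrow> \<not> inj \<omega> \<or> (\<exists>p. infinite_decreasing_path \<nu> \<omega> p)"

definition limit_algorithm :: "nat \<Rightarrow> 'd::finite config set \<Rightarrow> 'd clocks \<Rightarrow> 'd config"
  where "limit_algorithm \<nu> S \<omega> =
    (if exceptional \<nu> \<omega> then (\<lambda>_. 0)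
     else (\<lambda>x. jamming_limit \<nu> S (armour \<nu> {x} \<omega>) \<omega> x))"

definition covariance :: "'a measure \<Rightarrow> ('a \<Rightarrow> real) \<Rightarrow> ('a \<Rightarrow> real) \<Rightarrow> real"
  where "covariance M X Y =
    (LINT w|M. (X w - (LINT v|M. X v)) * (Y w - (LINT v|M. Y v)))"

text \<open>
  If one of the variances vanishes, the quotient is \<open>0\<close> by the convention \<open>a / 0 = 0\<close>.
\<close>

definition correlation :: "'a measure \<Rightarrow> ('a \<Rightarrow> real) \<Rightarrow> ('a \<Rightarrow> real) \<Rightarrow> real"
  where "correlation M X Y =
    covariance M X Y / (sqrt (prob_space.variance M X) * sqrt (prob_space.variance M Y))"

definition site_correlation ::
    "nat \<Rightarrow> 'd::finite config set \<Rightarrow> 'd site \<Rightarrow> 'd site \<Rightarrow> real"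
  where "site_correlation \<nu> S x y =
    correlation Omega (\<lambda>\<omega>. real (limit_algorithm \<nu> S \<omega> x)) (\<lambda>\<omega>. real (limit_algorithm \<nu> S \<omega> y))"

end

theory Submission
  imports Defs
begin

text \<open>
  The state of a site is determined by the clocks on its armour, and the armour is rarely large.
  If it reaches farther than \<open>n * \<nu>\<close> from \<open>x\<close>, then a decreasing path with \<open>n\<close> steps starts at \<open>x\<close>.
  Along a given path with \<open>n + 1\<close> distinct sites all orderings of the clocks are equally likely, so
  the path is decreasing with probability \<open>1 / (n + 1)!\<close> (\<open>prob_decreasing_le\<close>). There are at most
  \<open>K ^ n\<close> paths, where \<open>K\<close> is the number of sites in a ball of radius \<open>\<nu>\<close>, whence the bound
  \<open>K ^ n / (n + 1)!\<close> of \<open>prob_descends_le\<close>. The factorial beats every exponential.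

  Up to an event with this small probability, \<open>P(x)\<close> therefore agrees with a function
  \<open>local_limit\<close> of the clocks in the ball of radius \<open>n * \<nu>\<close> around \<open>x\<close>. If \<open>2 * n * \<nu> < sup_norm x\<close>,
  the balls around \<open>0\<close> and \<open>x\<close> are disjoint and the two local functions are independent, so the
  covariance of \<open>P(0)\<close> and \<open>P(x)\<close> is at most four times the bound
  (\<open>covariance_limit_algorithm_le\<close>). The largest such \<open>n\<close> grows linearly in \<open>sup_norm x\<close>. Finally,
  the algorithm commutes with translations (\<open>limit_algorithm_translate\<close>), so the variance of \<open>P(x)\<close>
  is the same for all \<open>x\<close> and the correlation is a constant multiple of the covariance.

  For measurability and for passing from the limit algorithm to local functions it matters that
  the exceptional set is a measurable null set. By Koenig's lemma (\<open>infinite_descent_iff\<close>) an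
  infinite decreasing path exists exactly if decreasing paths of all lengths start at some
  site. This is a countable condition, and for each site it has probability \<open>0\<close> by the bound above.
\<close>

section \<open>Balls in the lattice\<close>

definition sup_ball :: "nat \<Rightarrow> 'd::finite site \<Rightarrow> 'd site set"
  where "sup_ball r x = {y. sup_norm (y - x) \<le> int r}"

lemma sup_norm_le_iff: "sup_norm (x::'d::finite site) \<le> k \<longleftrightarrow> (\<forall>i. \<bar>x $ i\<bar> \<le> k)"
  unfolding sup_norm_def by (subst Max_le_iff) auto

lemma sup_norm_triangle: "sup_norm (x + y :: 'd::finite site) \<le> sup_norm x + sup_norm y"
proof -
  have a: "\<bar>x $ i\<bar> \<le> sup_norm x" "\<bar>y $ i\<bar> \<le> sup_norm y" for i
    using sup_norm_le_iff[of x "sup_norm x"] sup_norm_le_iff[of y "sup_norm y"] by auto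
  have "\<bar>(x + y) $ i\<bar> \<le> sup_norm x + sup_norm y" for i
    using a[of i] by simp
  then show ?thesis
    by (simp add: sup_norm_le_iff)
qed

lemma sup_norm_minus_commute: "sup_norm (x - y :: 'd::finite site) = sup_norm (y - x)"
  unfolding sup_norm_def by (simp add: abs_minus_commute)

lemma sup_norm_zero [simp]: "sup_norm (0 :: 'd::finite site) = 0"
  unfolding sup_norm_def by simp

lemma sup_ball_conv_image: "sup_ball r (x::'d::finite site) = (+) x ` sup_ball r 0"
proof -
  have "y \<in> (+) x ` sup_ball r 0" if "y \<in> sup_ball r x" for y
    by (rule image_eqI[of _ _ "y - x"]) (use that in \<open>auto simp: sup_ball_def\<close>)
  then show ?thesis
    by (auto simp: sup_ball_def)
qed

lemma finite_sup_ball [simp]: "finite (sup_ball r (x::'d::finite site))"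
proof -
  have "sup_ball r 0 \<subseteq> vec_lambda ` (UNIV \<rightarrow>\<^sub>E {- int r..int r} :: ('d \<Rightarrow> int) set)"
  proof
    fix y :: "'d site" assume "y \<in> sup_ball r 0"
    then have "($) y \<in> UNIV \<rightarrow>\<^sub>E {- int r..int r}"
      by (auto simp: sup_ball_def sup_norm_le_iff abs_le_iff PiE_iff minus_le_iff)
    then show "y \<in> vec_lambda ` (UNIV \<rightarrow>\<^sub>E {- int r..int r})"
      by (metis image_eqI vec_nth_inverse)
  qed
  then have "finite (sup_ball r (0::'d site))"
    by (rule finite_subset) (auto intro!: finite_imageI finite_PiE)
  then show ?thesis
    by (subst sup_ball_conv_image) simp
qed

lemma card_sup_ball: "card (sup_ball r (x::'d::finite site)) = card (sup_ball r (0::'d site))"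
  by (subst sup_ball_conv_image) (simp add: card_image)

lemma disjoint_sup_ball:
  assumes "2 * int r < sup_norm (x - y :: 'd::finite site)"
  shows "sup_ball r x \<inter> sup_ball r y = {}"
proof -
  have False if "z \<in> sup_ball r x" "z \<in> sup_ball r y" for z
  proof -
    have "sup_norm (x - y) \<le> sup_norm (x - z) + sup_norm (z - y)"
      using sup_norm_triangle[of "x - z" "z - y"] by simp
    with that assms show False
      by (simp add: sup_ball_def sup_norm_minus_commute[of x z])
  qed
  then show ?thesis
    by blast
qed

section \<open>Decreasing paths\<close>

definition paths :: "nat \<Rightarrow> nat \<Rightarrow> 'd::finite site \<Rightarrow> 'd site list set"
  where "paths \<nu> n x = {xs. length xs = Suc n \<and> is_path \<nu> xs \<and> hd xs = x}"

lemma paths_0: "paths \<nu> 0 x = {[x]}"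
  by (auto simp: paths_def is_path_def length_Suc_conv)

lemma paths_Suc: "paths \<nu> (Suc n) x = (\<Union>y\<in>sup_ball \<nu> x. (#) x ` paths \<nu> n y)"
proof (intro set_eqI iffI)
  fix xs assume "xs \<in> paths \<nu> (Suc n) x"
  then obtain ys where "xs = x # ys" "length ys = Suc n" "is_path \<nu> ys" "hd ys \<in> sup_ball \<nu> x"
    by (auto simp: paths_def is_path_def length_Suc_conv successively_Cons sup_ball_def)
  then show "xs \<in> (\<Union>y\<in>sup_ball \<nu> x. (#) x ` paths \<nu> n y)"
    by (auto simp: paths_def)
qed (auto simp: paths_def is_path_def successively_Cons sup_ball_def)

lemma finite_paths [simp]: "finite (paths \<nu> n (x::'d::finite site))"
  by (induction n arbitrary: x) (auto simp: paths_0 paths_Suc)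

lemma card_paths_le: "card (paths \<nu> n (x::'d::finite site)) \<le> card (sup_ball \<nu> (0::'d site)) ^ n"
proof (induction n arbitrary: x)
  case (Suc n)
  have "card (paths \<nu> (Suc n) x) \<le> (\<Sum>y\<in>sup_ball \<nu> x. card ((#) x ` paths \<nu> n y))"
    unfolding paths_Suc by (rule card_UN_le) simp
  also have "\<dots> \<le> (\<Sum>y\<in>sup_ball \<nu> x. card (sup_ball \<nu> (0::'d site)) ^ n)"
    by (intro sum_mono order.trans[OF card_image_le Suc]) simp
  finally show ?case
    by (simp add: card_sup_ball[of \<nu> x])
qed (simp add: paths_0)

lemma set_paths_subset: "xs \<in> paths \<nu> n x \<Longrightarrow> set xs \<subseteq> sup_ball (n * \<nu>) x"
proof (induction n arbitrary: x xs)
  case 0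
  then show ?case by (simp add: paths_0 sup_ball_def)
next
  case (Suc n)
  then obtain y ys where y: "y \<in> sup_ball \<nu> x" and ys: "ys \<in> paths \<nu> n y" "xs = x # ys"
    by (auto simp: paths_Suc)
  have "z \<in> sup_ball (Suc n * \<nu>) x" if "z \<in> set ys" for z
  proof -
    have "z \<in> sup_ball (n * \<nu>) y"
      using Suc.IH[OF ys(1)] that by blast
    then show ?thesis
      using sup_norm_triangle[of "z - y" "y - x"] y by (simp add: sup_ball_def)
  qed
  then show ?case
    using ys by (auto simp: sup_ball_def)
qed

definition descends :: "nat \<Rightarrow> nat \<Rightarrow> 'd::finite site \<Rightarrow> 'd clocks \<Rightarrow> bool"
  where "descends \<nu> n x \<omega> \<longleftrightarrow> (\<exists>xs\<in>paths \<nu> n x. decreasing \<omega> xs)"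

lemma descends_Suc: "descends \<nu> (Suc n) x \<omega> \<longleftrightarrow> (\<exists>y\<in>sup_ball \<nu> x. \<omega> y < \<omega> x \<and> descends \<nu> n y \<omega>)"
proof -
  have "decreasing \<omega> (x # xs) \<longleftrightarrow> \<omega> y < \<omega> x \<and> decreasing \<omega> xs" if "xs \<in> paths \<nu> n y" for y xs
    using that by (auto simp: decreasing_def successively_Cons paths_def)
  then show ?thesis
    unfolding descends_def paths_Suc by blast
qed

lemma descends_0 [simp]: "descends \<nu> 0 x \<omega>"
  by (simp add: descends_def paths_0 decreasing_def)

lemma descends_antimono:
  assumes "m \<le> n" "descends \<nu> n x \<omega>"
  shows "descends \<nu> m x \<omega>"
proof -
  have "descends \<nu> n x \<omega>" if "descends \<nu> (Suc n) x \<omega>" for n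
    using that by (induction n arbitrary: x) (auto simp: descends_Suc)
  with assms show ?thesis
    by (induction n rule: dec_induct) auto
qed

text \<open>
  This is Koenig's lemma: a site has finitely many neighbours, so a site from which arbitrarily
  long decreasing paths start has a smaller neighbour with the same property. It turns the
  existence of an infinite path, a quantification over uncountably many sequences, into countably
  many conditions, each on finitely many clocks, which makes the exceptional set measurable. It
  also bounds the length of the decreasing paths from each site outside the exceptional set, so
  that armours are finite there.
\<close>

lemma infinite_descent_iff:
  "(\<exists>p. infinite_decreasing_path \<nu> \<omega> p) \<longleftrightarrow> (\<exists>x. \<forall>n. descends \<nu> n x \<omega>)"
proof
  assume "\<exists>p. infinite_decreasing_path \<nu> \<omega> p"
  then obtain p where p: "infinite_decreasing_path \<nu> \<omega> p"
    by blast
  have "descends \<nu> n (p i) \<omega>" for n i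
  proof (induction n arbitrary: i)
    case (Suc n)
    have "p (Suc i) \<in> sup_ball \<nu> (p i)" "\<omega> (p (Suc i)) < \<omega> (p i)"
      using p by (auto simp: infinite_decreasing_path_def sup_ball_def)
    with Suc show ?case
      by (auto simp: descends_Suc)
  qed simp
  then show "\<exists>x. \<forall>n. descends \<nu> n x \<omega>"
    by blast
next
  assume "\<exists>x. \<forall>n. descends \<nu> n x \<omega>"
  then obtain x where x: "\<forall>n. descends \<nu> n x \<omega>"
    by blast
  have "\<exists>z. (\<forall>n. descends \<nu> n z \<omega>) \<and> z \<in> sup_ball \<nu> y \<and> \<omega> z < \<omega> y"
    if y: "\<forall>n. descends \<nu> n y \<omega>" for y
  proof (rule ccontr)
    assume no: "\<nexists>z. (\<forall>n. descends \<nu> n z \<omega>) \<and> z \<in> sup_ball \<nu> y \<and> \<omega> z < \<omega> y"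
    define B where "B = {z \<in> sup_ball \<nu> y. \<omega> z < \<omega> y}"
    have "\<forall>z\<in>B. \<exists>n. \<not> descends \<nu> n z \<omega>"
      using no by (auto simp: B_def)
    then obtain f where f: "\<And>z. z \<in> B \<Longrightarrow> \<not> descends \<nu> (f z) z \<omega>"
      by metis
    have "finite B"
      by (simp add: B_def)
    \<comment> \<open>One length defeats all the finitely many smaller neighbours at once.\<close>
    obtain z where "z \<in> B" "descends \<nu> (Max (f ` B)) z \<omega>"
      using y[rule_format, of "Suc (Max (f ` B))"] by (auto simp: descends_Suc B_def)
    moreover have "f z \<le> Max (f ` B)"
      using \<open>finite B\<close> \<open>z \<in> B\<close> by simp
    ultimately show False
      using f descends_antimono by blast
  qed
  then obtain p where "p 0 = x" "\<And>n. \<forall>k. descends \<nu> k (p n) \<omega>"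
      "\<And>n. p (Suc n) \<in> sup_ball \<nu> (p n) \<and> \<omega> (p (Suc n)) < \<omega> (p n)"
    using dependent_nat_choice[of "\<lambda>n y. (\<forall>k. descends \<nu> k y \<omega>) \<and> (n = 0 \<longrightarrow> y = x)"
        "\<lambda>n y z. z \<in> sup_ball \<nu> y \<and> \<omega> z < \<omega> y"] x by blast
  then show "\<exists>p. infinite_decreasing_path \<nu> \<omega> p"
    by (auto simp: infinite_decreasing_path_def sup_ball_def)
qed

lemma exceptional_iff: "exceptional \<nu> \<omega> \<longleftrightarrow> \<not> inj \<omega> \<or> (\<exists>x. \<forall>n. descends \<nu> n x \<omega>)"
  by (simp add: exceptional_def infinite_descent_iff)

section \<open>Locality of the armour and of the jamming limit\<close>

text \<open>
  All quantities of the process depend on the clocks only through their relative order. This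
  relation therefore serves as the notion of locality: a function invariant under
  \<open>same_order B\<close> depends only on the clocks in \<open>B\<close>, and takes finitely many values if \<open>B\<close> is
  finite.
\<close>

definition same_order :: "'a set \<Rightarrow> ('a \<Rightarrow> real) \<Rightarrow> ('a \<Rightarrow> real) \<Rightarrow> bool"
  where "same_order B \<omega> \<omega>' \<longleftrightarrow> (\<forall>a\<in>B. \<forall>b\<in>B. \<omega> a < \<omega> b \<longleftrightarrow> \<omega>' a < \<omega>' b)"

lemma same_order_sym: "same_order B \<omega> \<omega>' \<Longrightarrow> same_order B \<omega>' \<omega>"
  by (auto simp: same_order_def)

lemma same_order_subset: "same_order B \<omega> \<omega>' \<Longrightarrow> C \<subseteq> B \<Longrightarrow> same_order C \<omega> \<omega>'"
  by (auto simp: same_order_def)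

lemma same_order_inj_on: "same_order B \<omega> \<omega>' \<Longrightarrow> inj_on \<omega> B \<longleftrightarrow> inj_on \<omega>' B"
  by (auto simp: same_order_def inj_on_def) (metis linorder_neq_iff)+

lemma same_order_decreasing:
  assumes "same_order B \<omega> \<omega>'" "set xs \<subseteq> B"
  shows "decreasing \<omega> xs \<longleftrightarrow> decreasing \<omega>' xs"
  unfolding decreasing_def
  by (rule successively_cong) (use assms in \<open>auto simp: same_order_def\<close>)

lemma same_order_descends:
  assumes "same_order (sup_ball (n * \<nu>) x) \<omega> \<omega>'"
  shows "descends \<nu> n x \<omega> \<longleftrightarrow> descends \<nu> n x \<omega>'"
  unfolding descends_def
  by (intro bex_cong refl same_order_decreasing[OF assms] set_paths_subset)

text \<open>
  A decreasing path with \<open>n\<close> steps or more would have an initial piece with exactly \<open>n\<close> steps. So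
  all decreasing paths from \<open>x\<close> are shorter than \<open>n\<close> steps and cannot travel farther than
  \<open>n * \<nu>\<close>.
\<close>

lemma decreasing_path_short:
  assumes nd: "\<not> descends \<nu> n x \<omega>"
    and xs: "is_path \<nu> xs" "hd xs = x" "decreasing \<omega> xs"
  shows "set xs \<subseteq> sup_ball (n * \<nu>) x"
proof -
  define m where "m = length xs - 1"
  have m: "xs \<in> paths \<nu> m x"
    using xs by (auto simp: paths_def m_def is_path_def)
  then have "descends \<nu> m x \<omega>"
    using xs by (auto simp: descends_def)
  then have "m < n"
    using nd descends_antimono[of n m] by (meson not_le)
  then have "int (m * \<nu>) \<le> int (n * \<nu>)"
    by (intro of_nat_mono mult_right_mono) auto
  then have "sup_ball (m * \<nu>) x \<subseteq> sup_ball (n * \<nu>) x"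
    unfolding sup_ball_def by (auto intro: order.trans)
  then show ?thesis
    using set_paths_subset[OF m] by blast
qed

lemma armour_subset_sup_ball:
  assumes "\<not> descends \<nu> n x \<omega>"
  shows "armour \<nu> {x} \<omega> \<subseteq> sup_ball (n * \<nu>) x"
proof
  fix y assume "y \<in> armour \<nu> {x} \<omega>"
  then obtain xs where "is_path \<nu> xs" "hd xs = x" "decreasing \<omega> xs" "last xs = y"
    by (auto simp: armour_def leads_up_def)
  then show "y \<in> sup_ball (n * \<nu>) x"
    using decreasing_path_short[OF assms, of xs] last_in_set[of xs] by (auto simp: is_path_def)
qed

text \<open>
  It is enough to compare the clocks inside the ball: by \<open>decreasing_path_short\<close> no
  decreasing path for either clock configuration leaves it.
\<close>

lemma same_order_armour:
  assumes so: "same_order (sup_ball (n * \<nu>) x) \<omega> \<omega>'" and nd: "\<not> descends \<nu> n x \<omega>"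
  shows "armour \<nu> {x} \<omega> = armour \<nu> {x} \<omega>'"
proof -
  have sub: "armour \<nu> {x} \<omega> \<subseteq> armour \<nu> {x} \<omega>'"
    if so: "same_order (sup_ball (n * \<nu>) x) \<omega> \<omega>'" and nd: "\<not> descends \<nu> n x \<omega>" for \<omega> \<omega>'
  proof
    fix y assume "y \<in> armour \<nu> {x} \<omega>"
    then obtain xs where xs: "is_path \<nu> xs" "hd xs = x" "decreasing \<omega> xs" "last xs = y"
      by (auto simp: armour_def leads_up_def)
    then have "decreasing \<omega>' xs"
      using same_order_decreasing[OF so] decreasing_path_short[OF nd] by blast
    with xs show "y \<in> armour \<nu> {x} \<omega>'"
      by (auto simp: armour_def leads_up_def)
  qed
  show ?thesis
    using sub[OF so nd] sub[OF same_order_sym[OF so]] same_order_descends[OF so] nd by blast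
qed

text \<open>
  The next two lemmas characterise the order of visits. They hold in the class context because
  the locale \<open>folding_insort_key\<close> speaks of the sorting function of an abstract linear order.
\<close>

lemma (in linorder) sorted_key_list_eqI:
  fixes f :: "'b \<Rightarrow> 'a"
  assumes "finite X" "inj_on f X" "set xs = X" "sorted_wrt (\<lambda>a b. f a < f b) xs"
  shows "sorted_key_list_of_set f X = xs"
proof -
  interpret folding_insort_key "(\<le>)" "(<)" X f
    by standard fact
  have "distinct xs"
    using assms(4) by (induction xs) auto
  then show ?thesis
    using assms distinct_card[of xs] sorted_key_list_of_set_unique[of X xs]
    by (simp add: sorted_wrt_map)
qed

lemma (in linorder) sorted_key_list_props:
  fixes f :: "'b \<Rightarrow> 'a"
  assumes "finite X" "inj_on f X"
  shows "set (sorted_key_list_of_set f X) = X"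
    "sorted_wrt (\<lambda>a b. f a < f b) (sorted_key_list_of_set f X)"
proof -
  interpret folding_insort_key "(\<le>)" "(<)" X f
    by standard fact
  show "set (sorted_key_list_of_set f X) = X"
    using assms(1) by simp
  show "sorted_wrt (\<lambda>a b. f a < f b) (sorted_key_list_of_set f X)"
    using strict_sorted_key_list_of_set[of X] by (simp add: sorted_wrt_map)
qed

lemma same_order_jamming_limit:
  assumes "finite X" "inj_on \<omega> X" "same_order X \<omega> \<omega>'"
  shows "jamming_limit \<nu> S X \<omega> = jamming_limit \<nu> S X \<omega>'"
proof -
  note p = sorted_key_list_props[OF assms(1,2)]
  have "sorted_key_list_of_set \<omega>' X = sorted_key_list_of_set \<omega> X"
  proof (rule sorted_key_list_eqI)
    show "inj_on \<omega>' X"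
      using assms same_order_inj_on by blast
    show "sorted_wrt (\<lambda>a b. \<omega>' a < \<omega>' b) (sorted_key_list_of_set \<omega> X)"
      by (rule sorted_wrt_mono_rel[OF _ p(2)]) (use p(1) assms(3) in \<open>auto simp: same_order_def\<close>)
  qed (use p assms in auto)
  then show ?thesis
    by (simp add: jamming_limit_def)
qed

lemma jamming_limit_le_1: "jamming_limit \<nu> S X \<omega> x \<le> 1"
proof -
  have "\<eta> x \<le> 1 \<Longrightarrow> fold (park_step \<nu> S) xs \<eta> x \<le> 1" for xs \<eta>
    by (induction xs arbitrary: \<eta>) (auto simp: park_step_def)
  then show ?thesis
    by (simp add: jamming_limit_def)
qed

lemma limit_algorithm_le_1: "limit_algorithm \<nu> S \<omega> x \<le> 1"
  using jamming_limit_le_1 by (auto simp: limit_algorithm_def)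

text \<open>
  The limit algorithm seen through the ball of radius \<open>n * \<nu>\<close> around \<open>x\<close>. If a decreasing path
  with \<open>n\<close> steps starts at \<open>x\<close>, the armour may reach out of the ball; if two clocks in the ball
  coincide, the order of visits is not determined. The value \<open>0\<close> in both cases makes the function
  depend on the order of the clocks in the ball alone.
\<close>

definition local_limit ::
    "nat \<Rightarrow> 'd::finite config set \<Rightarrow> nat \<Rightarrow> 'd clocks \<Rightarrow> 'd site \<Rightarrow> nat"
  where "local_limit \<nu> S n \<omega> x =
    (if inj_on \<omega> (sup_ball (n * \<nu>) x) \<and> \<not> descends \<nu> n x \<omega>
     then jamming_limit \<nu> S (armour \<nu> {x} \<omega>) \<omega> x else 0)"

lemma local_limit_le_1: "local_limit \<nu> S n \<omega> x \<le> 1"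
  using jamming_limit_le_1 by (auto simp: local_limit_def)

lemma same_order_local_limit:
  assumes so: "same_order (sup_ball (n * \<nu>) x) \<omega> \<omega>'"
  shows "local_limit \<nu> S n \<omega> x = local_limit \<nu> S n \<omega>' x"
proof (cases "inj_on \<omega> (sup_ball (n * \<nu>) x) \<and> \<not> descends \<nu> n x \<omega>")
  case True
  then have sub: "armour \<nu> {x} \<omega> \<subseteq> sup_ball (n * \<nu>) x"
    by (simp add: armour_subset_sup_ball)
  have "jamming_limit \<nu> S (armour \<nu> {x} \<omega>) \<omega> = jamming_limit \<nu> S (armour \<nu> {x} \<omega>) \<omega>'"
    by (rule same_order_jamming_limit)
      (use True sub so in \<open>auto intro: finite_subset inj_on_subset same_order_subset\<close>)
  then show ?thesis
    using True same_order_armour[OF so] same_order_inj_on[OF so] same_order_descends[OF so]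
    by (simp add: local_limit_def)
qed (use same_order_inj_on[OF so] same_order_descends[OF so] in \<open>auto simp: local_limit_def\<close>)

lemma limit_algorithm_eq_local_limit:
  assumes "\<not> exceptional \<nu> \<omega>" "\<not> descends \<nu> n x \<omega>"
  shows "limit_algorithm \<nu> S \<omega> x = local_limit \<nu> S n \<omega> x"
  using assms
  by (auto simp: limit_algorithm_def local_limit_def exceptional_def intro: inj_on_subset)

section \<open>Translation equivariance\<close>

text \<open>
  The map \<open>translate\<close> for functions with values in any type, so that clocks can be translated as
  well as configurations.
\<close>

definition shift :: "'d::finite site \<Rightarrow> ('d site \<Rightarrow> 'a) \<Rightarrow> 'd site \<Rightarrow> 'a"
  where "shift y \<eta> = (\<lambda>z. \<eta> (z + y))"

lemma shift_apply [simp]: "shift y \<eta> z = \<eta> (z + y)"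
  by (simp add: shift_def)

lemma translate_eq_shift: "translate = shift"
  by (simp add: fun_eq_iff translate_def)

lemma path_translate:
  "is_path \<nu> (map (\<lambda>z. z + y) xs) \<longleftrightarrow> is_path \<nu> xs"
  "decreasing \<omega> (map (\<lambda>z. z + y) xs) \<longleftrightarrow> decreasing (shift y \<omega>) xs"
  by (simp_all add: is_path_def decreasing_def successively_map)

lemma leads_up_translate:
  "leads_up \<nu> (shift y \<omega>) a b \<longleftrightarrow> leads_up \<nu> \<omega> (a + y) (b + y)"
proof
  assume "leads_up \<nu> (shift y \<omega>) a b"
  then obtain xs where xs: "is_path \<nu> xs" "decreasing (shift y \<omega>) xs" "hd xs = b" "last xs = a"
    by (auto simp: leads_up_def)
  then have "xs \<noteq> []"
    by (simp add: is_path_def)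
  then show "leads_up \<nu> \<omega> (a + y) (b + y)"
    unfolding leads_up_def using xs
    by (intro exI[of _ "map (\<lambda>z. z + y) xs"]) (simp add: path_translate hd_map last_map)
next
  assume "leads_up \<nu> \<omega> (a + y) (b + y)"
  then obtain xs where xs: "is_path \<nu> xs" "decreasing \<omega> xs" "hd xs = b + y" "last xs = a + y"
    by (auto simp: leads_up_def)
  define zs where "zs = map (\<lambda>z. z - y) xs"
  have "xs = map (\<lambda>z. z + y) zs" "xs \<noteq> []" "zs \<noteq> []"
    using xs by (auto simp: zs_def is_path_def comp_def)
  then show "leads_up \<nu> (shift y \<omega>) a b"
    unfolding leads_up_def using xs
    by (intro exI[of _ zs]) (auto simp: path_translate hd_map last_map)
qed

lemma armour_translate:
  "armour \<nu> {x + y} \<omega> = (\<lambda>z. z + y) ` armour \<nu> {x} (shift y \<omega>)"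
proof -
  have "z \<in> (\<lambda>z. z + y) ` armour \<nu> {x} (shift y \<omega>)" if "leads_up \<nu> \<omega> z (x + y)" for z
    by (rule image_eqI[of _ _ "z - y"]) (use that in \<open>auto simp: armour_def leads_up_translate\<close>)
  then show ?thesis
    by (auto simp: armour_def leads_up_translate)
qed

lemma exceptional_translate: "exceptional \<nu> (shift y \<omega>) \<longleftrightarrow> exceptional \<nu> \<omega>"
proof -
  have tr: "exceptional \<nu> \<omega>" if "exceptional \<nu> (shift y \<omega>)" for y and \<omega> :: "'a clocks"
    using that unfolding exceptional_def
  proof (elim disjE exE)
    assume "\<not> inj (shift y \<omega>)"
    moreover have "inj (shift y \<omega>)" if "inj \<omega>"
      using that by (metis add_right_cancel injD injI shift_apply)
    ultimately show "\<not> inj \<omega> \<or> (\<exists>p. infinite_decreasing_path \<nu> \<omega> p)"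
      by blast
  next
    fix p assume "infinite_decreasing_path \<nu> (shift y \<omega>) p"
    then have "infinite_decreasing_path \<nu> \<omega> (\<lambda>i. p i + y)"
      by (simp add: infinite_decreasing_path_def)
    then show "\<not> inj \<omega> \<or> (\<exists>p. infinite_decreasing_path \<nu> \<omega> p)"
      by blast
  qed
  have "shift (- y) (shift y \<omega>) = \<omega>"
    by (simp add: shift_def)
  then show ?thesis
    using tr[of y \<omega>] tr[of "- y" "shift y \<omega>"] by auto
qed

lemma fold_park_step_translate:
  "shift y (fold (park_step \<nu> S) (map (\<lambda>z. z + y) xs) \<eta>) =
    fold (park_step \<nu> S) xs (shift y \<eta>)"
proof (induction xs arbitrary: \<eta>)
  case (Cons x xs)
  have "shift (x + y) \<eta> = shift x (shift y \<eta>)"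
    by (simp add: shift_def add.assoc)
  moreover have "shift y (\<eta>(x + y := 1)) = (shift y \<eta>)(x := 1)"
    by (auto simp: shift_def)
  ultimately have "shift y (park_step \<nu> S (x + y) \<eta>) = park_step \<nu> S x (shift y \<eta>)"
    by (simp add: park_step_def translate_eq_shift)
  then show ?case
    by (simp add: Cons del: shift_apply)
qed simp

lemma jamming_limit_translate:
  assumes "finite X" "inj_on (shift y \<omega>) X"
  shows "shift y (jamming_limit \<nu> S ((\<lambda>z. z + y) ` X) \<omega>) = jamming_limit \<nu> S X (shift y \<omega>)"
proof -
  note p = sorted_key_list_props[OF assms]
  have "sorted_key_list_of_set \<omega> ((\<lambda>z. z + y) ` X) =
      map (\<lambda>z. z + y) (sorted_key_list_of_set (shift y \<omega>) X)"
    by (rule sorted_key_list_eqI) (use assms p in \<open>auto simp: sorted_wrt_map inj_on_def\<close>)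
  moreover have "shift y (\<lambda>_. 0) = (\<lambda>_. 0 :: nat)"
    by (simp add: shift_def)
  ultimately show ?thesis
    by (simp add: jamming_limit_def fold_park_step_translate)
qed

text \<open>
  The armour, the order of visits and the parking rule are all described relative to the visited
  site. Hence moving the observed site has the same effect as moving the clocks the other way;
  since the law of the clocks is invariant, all \<open>P(x)\<close> have the same variance.
\<close>

lemma limit_algorithm_translate:
  "limit_algorithm \<nu> S (shift y \<omega>) x = limit_algorithm \<nu> S \<omega> (x + y)"
proof (cases "exceptional \<nu> \<omega>")
  case True
  then show ?thesis
    by (simp add: limit_algorithm_def exceptional_translate)
next
  case False
  then have ne: "\<not> exceptional \<nu> (shift y \<omega>)"
    by (simp add: exceptional_translate)
  then obtain n where "\<not> descends \<nu> n x (shift y \<omega>)"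
    by (auto simp: exceptional_iff)
  then have "finite (armour \<nu> {x} (shift y \<omega>))"
    using armour_subset_sup_ball finite_subset finite_sup_ball by metis
  moreover have "inj_on (shift y \<omega>) (armour \<nu> {x} (shift y \<omega>))"
    using ne by (auto simp: exceptional_iff intro: inj_on_subset)
  ultimately have "shift y (jamming_limit \<nu> S (armour \<nu> {x + y} \<omega>) \<omega>) =
      jamming_limit \<nu> S (armour \<nu> {x} (shift y \<omega>)) (shift y \<omega>)"
    unfolding armour_translate by (rule jamming_limit_translate)
  from fun_cong[OF this, of x] show ?thesis
    using False ne by (simp add: limit_algorithm_def)
qed

section \<open>The probability space\<close>

abbreviation clock_law :: "real measure"
  where "clock_law \<equiv> restrict_space lborel {0<..<1}"

lemma prob_space_clock_law: "prob_space clock_law"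
  by (rule prob_space_restrict_space) auto

interpretation Omega: prob_space "Omega :: 'd::finite clocks measure"
  unfolding Omega_def by (intro prob_space_PiM prob_space_clock_law)

lemma AE_clock_law_neq: "AE u in clock_law. u \<noteq> c"
  by (subst AE_restrict_space_iff) (use AE_lborel_singleton[of c] in auto)

lemma measurable_clock:
  assumes "a \<in> I"
  shows "(\<lambda>\<omega>. \<omega> a) \<in> borel_measurable (\<Pi>\<^sub>M x\<in>I. clock_law)"
  using measurable_component_singleton[OF assms, of "\<lambda>_. clock_law"]
  by (simp add: measurable_restrict_space2_iff)

text \<open>
  Such a function factors through the finite set of pairs in \<open>B\<close> whose clocks are in increasing
  order. The index set \<open>I\<close> is arbitrary so that the lemma applies both to the full
  product space and, for independence, to the product over \<open>B\<close> alone.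
\<close>

lemma measurable_order_local:
  fixes f :: "('a \<Rightarrow> real) \<Rightarrow> 'b"
  assumes B: "finite B" "B \<subseteq> I"
    and f: "\<And>\<omega> \<omega>'. same_order B \<omega> \<omega>' \<Longrightarrow> f \<omega> = f \<omega>'"
  shows "f \<in> (\<Pi>\<^sub>M x\<in>I. clock_law) \<rightarrow>\<^sub>M count_space UNIV"
proof -
  define rel where "rel \<omega> = {p \<in> B \<times> B. \<omega> (fst p) < \<omega> (snd p)}" for \<omega> :: "'a \<Rightarrow> real"
  define g where "g R = f (SOME \<omega>. rel \<omega> = R)" for R
  have g: "g (rel \<omega>) = f \<omega>" for \<omega>
  proof -
    have "rel (SOME \<omega>'. rel \<omega>' = rel \<omega>) = rel \<omega>"
      by (rule someI[of "\<lambda>\<omega>'. rel \<omega>' = rel \<omega>"]) simp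
    then have "same_order B (SOME \<omega>'. rel \<omega>' = rel \<omega>) \<omega>"
      by (auto simp: rel_def same_order_def set_eq_iff)
    then show ?thesis
      by (simp add: g_def f)
  qed
  have "rel \<in> (\<Pi>\<^sub>M x\<in>I. clock_law) \<rightarrow>\<^sub>M count_space (Pow (B \<times> B))"
  proof (subst measurable_count_space_eq2, safe)
    fix R assume R: "R \<subseteq> B \<times> B"
    have [measurable]: "(\<lambda>\<omega>. \<omega> a) \<in> borel_measurable (\<Pi>\<^sub>M x\<in>I. clock_law)" if "a \<in> B" for a
      using that B by (intro measurable_clock) auto
    have "rel -` {R} \<inter> space (\<Pi>\<^sub>M x\<in>I. clock_law) =
        {\<omega> \<in> space (\<Pi>\<^sub>M x\<in>I. clock_law). \<forall>a\<in>B. \<forall>b\<in>B. (a, b) \<in> R \<longleftrightarrow> \<omega> a < \<omega> b}"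
      using R by (auto simp: rel_def set_eq_iff)
    also have "\<dots> \<in> sets (\<Pi>\<^sub>M x\<in>I. clock_law)"
      using B(1) by (intro sets.sets_Collect_finite_All) measurable
    finally show "rel -` {R} \<inter> space (\<Pi>\<^sub>M x\<in>I. clock_law) \<in> sets (\<Pi>\<^sub>M x\<in>I. clock_law)" .
  qed (use B(1) in \<open>auto simp: rel_def\<close>)
  then have "(\<lambda>\<omega>. g (rel \<omega>)) \<in> (\<Pi>\<^sub>M x\<in>I. clock_law) \<rightarrow>\<^sub>M count_space UNIV"
    by (rule measurable_compose) simp
  then show ?thesis
    by (simp add: g)
qed

lemma indep_clocks: "Omega.indep_vars (\<lambda>_. clock_law) (\<lambda>x \<omega>. \<omega> x) (UNIV :: 'd::finite site set)"
proof (subst Omega.indep_vars_iff_distr_eq_PiM')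
  show "(\<lambda>\<omega>. \<omega> x) \<in> Omega \<rightarrow>\<^sub>M clock_law" for x :: "'d site"
    unfolding Omega_def by simp
  have "distr Omega clock_law (\<lambda>\<omega>. \<omega> x) = clock_law" for x :: "'d site"
    unfolding Omega_def by (rule distr_PiM_component) (auto intro: prob_space_clock_law)
  moreover have "distr Omega Omega (\<lambda>\<omega>::'d clocks. \<omega>) = Omega"
    by (rule distr_id)
  ultimately show "distr Omega (\<Pi>\<^sub>M x\<in>UNIV. clock_law) (\<lambda>\<omega>. \<lambda>x\<in>UNIV. \<omega> x) =
      (\<Pi>\<^sub>M x\<in>(UNIV :: 'd site set). distr Omega clock_law (\<lambda>\<omega>. \<omega> x))"
    by (simp add: Omega_def restrict_UNIV)
qed simp

text \<open>
  Functions of the clocks on disjoint sets are independent. Being local, \<open>f\<close> and \<open>g\<close> do not see that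
  the clocks outside \<open>B\<close> and \<open>C\<close> are replaced by \<open>undefined\<close> under \<open>restrict\<close>.
\<close>

lemma expectation_mult_order_local:
  fixes f g :: "'d::finite clocks \<Rightarrow> nat"
  assumes "finite B" "finite C" and disj: "B \<inter> C = {}"
    and f: "\<And>\<omega> \<omega>'. same_order B \<omega> \<omega>' \<Longrightarrow> f \<omega> = f \<omega>'" "\<And>\<omega>. f \<omega> \<le> 1"
    and g: "\<And>\<omega> \<omega>'. same_order C \<omega> \<omega>' \<Longrightarrow> g \<omega> = g \<omega>'" "\<And>\<omega>. g \<omega> \<le> 1"
  shows "(LINT \<omega>|Omega. real (f \<omega>) * real (g \<omega>)) =
    (LINT \<omega>|Omega. real (f \<omega>)) * (LINT \<omega>|Omega. real (g \<omega>))"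
proof -
  have "Omega.indep_var borel ((\<lambda>\<omega>. real (f \<omega>)) \<circ> (\<lambda>\<omega>. restrict \<omega> B))
      borel ((\<lambda>\<omega>. real (g \<omega>)) \<circ> (\<lambda>\<omega>. restrict \<omega> C))"
  proof (rule Omega.indep_var_compose)
    show "Omega.indep_var (\<Pi>\<^sub>M x\<in>B. clock_law) (\<lambda>\<omega>. restrict \<omega> B) (\<Pi>\<^sub>M x\<in>C. clock_law) (\<lambda>\<omega>. restrict \<omega> C)"
      using Omega.indep_var_restrict[OF indep_clocks disj] by simp
    show "(\<lambda>\<omega>. real (f \<omega>)) \<in> borel_measurable (\<Pi>\<^sub>M x\<in>B. clock_law)"
      by (rule measurable_compose[OF measurable_order_local[of B]]) (use assms in auto)
    show "(\<lambda>\<omega>. real (g \<omega>)) \<in> borel_measurable (\<Pi>\<^sub>M x\<in>C. clock_law)"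
      by (rule measurable_compose[OF measurable_order_local[of C]]) (use assms in auto)
  qed
  moreover have "f (restrict \<omega> B) = f \<omega>" "g (restrict \<omega> C) = g \<omega>" for \<omega>
    by (auto intro!: f g simp: same_order_def)
  ultimately have ind: "Omega.indep_var borel (\<lambda>\<omega>. real (f \<omega>)) borel (\<lambda>\<omega>. real (g \<omega>))"
    by (simp add: comp_def)
  show ?thesis
  proof (rule Omega.indep_var_lebesgue_integral[OF ind])
    show "integrable Omega (\<lambda>\<omega>. real (f \<omega>))"
      by (rule Omega.integrable_const_bound[of _ 1])
        (use f Omega.indep_var_rv1[OF ind] in auto)
    show "integrable Omega (\<lambda>\<omega>. real (g \<omega>))"
      by (rule Omega.integrable_const_bound[of _ 1])
        (use g Omega.indep_var_rv2[OF ind] in auto)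
  qed
qed

text \<open>
  The clocks are identically distributed, so relabelling the sites preserves their joint law. This
  serves twice: for permutations of the sites of a path and for translations of the lattice.
\<close>

lemma distr_Omega_reindex:
  assumes "inj \<tau>"
  shows "distr Omega Omega (\<lambda>\<omega>. \<omega> \<circ> \<tau>) = (Omega :: 'd::finite clocks measure)"
  using distr_PiM_reindex[of UNIV "\<lambda>_. clock_law" \<tau> UNIV] assms
  by (simp add: Omega_def restrict_UNIV prob_space_clock_law comp_def)

lemma measurable_Omega_reindex: "(\<lambda>\<omega>. \<omega> \<circ> \<tau>) \<in> Omega \<rightarrow>\<^sub>M (Omega :: 'd::finite clocks measure)"
  unfolding Omega_def
  by (rule measurable_PiM_single') (auto simp: space_PiM PiE_iff comp_def)

section \<open>Long decreasing paths are unlikely\<close>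

lemma sets_decreasing [measurable]: "{\<omega> \<in> space Omega. decreasing \<omega> xs} \<in> sets Omega"
proof -
  have "(\<lambda>\<omega>. decreasing \<omega> xs) \<in> Omega \<rightarrow>\<^sub>M count_space UNIV"
    unfolding Omega_def
    by (rule measurable_order_local[OF _ _ same_order_decreasing[OF _ order_refl]]) auto
  then show ?thesis
    by measurable
qed

lemma decreasing_iff_sorted_wrt: "decreasing \<omega> xs \<longleftrightarrow> sorted_wrt (\<lambda>x y. \<omega> x > \<omega> y) xs"
  unfolding decreasing_def by (rule successively_conv_sorted_wrt) (auto simp: transp_def)

lemma decreasing_imp_distinct: "decreasing \<omega> xs \<Longrightarrow> distinct xs"
  unfolding decreasing_iff_sorted_wrt by (induction xs) auto

lemma decreasing_comp: "decreasing (\<omega> \<circ> \<pi>) xs \<longleftrightarrow> decreasing \<omega> (map \<pi> xs)"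
  by (simp add: decreasing_def successively_map)

lemma decreasing_unique:
  assumes "decreasing \<omega> xs" "decreasing \<omega> ys" "set xs = set ys"
  shows "xs = ys"
proof -
  have *: "sorted_key_list_of_set \<omega> (set zs) = rev zs" if "decreasing \<omega> zs" for zs
  proof (rule sorted_key_list_eqI)
    have "distinct (map \<omega> zs)"
      using that unfolding decreasing_iff_sorted_wrt by (induction zs) auto
    then show "inj_on \<omega> (set zs)"
      by (simp add: distinct_map)
  qed (use that in \<open>auto simp: decreasing_iff_sorted_wrt sorted_wrt_rev\<close>)
  show ?thesis
    using *[OF assms(1)] *[OF assms(2)] assms(3) by (metis rev_rev_ident)
qed

text \<open>
  All orderings of the clocks along the path are equally likely by exchangeability and mutually
  exclusive, and there are \<open>fact (length xs)\<close> of them. A path that visits a site twice cannot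
  be decreasing at all.
\<close>

lemma prob_decreasing_le:
  fixes xs :: "'d::finite site list"
  shows "measure Omega {\<omega> \<in> space Omega. decreasing \<omega> xs} \<le> 1 / fact (length xs)"
proof (cases "distinct xs")
  case False
  then have "{\<omega> \<in> space Omega. decreasing \<omega> xs} = {}"
    using decreasing_imp_distinct by blast
  then show ?thesis
    by (simp only: measure_empty) simp
next
  case True
  define perms where "perms = {\<pi>. \<pi> permutes set xs}"
  define D where "D \<pi> = {\<omega> \<in> space Omega. decreasing \<omega> (map \<pi> xs)}" for \<pi> :: "'d site \<Rightarrow> 'd site"
  have card: "card perms = fact (length xs)"
    unfolding perms_def using True by (intro card_permutations) (auto simp: distinct_card)
  have fin: "finite perms"
    unfolding perms_def by (rule finite_permutations) simp
  have D_eq: "measure Omega (D \<pi>) = measure Omega {\<omega> \<in> space Omega. decreasing \<omega> xs}"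
    if "\<pi> \<in> perms" for \<pi>
  proof -
    have "inj \<pi>"
      using that by (auto simp: perms_def intro: permutes_inj)
    have "measure Omega {\<omega> \<in> space Omega. decreasing \<omega> xs} =
        measure (distr Omega Omega (\<lambda>\<omega>. \<omega> \<circ> \<pi>)) {\<omega> \<in> space Omega. decreasing \<omega> xs}"
      by (simp add: distr_Omega_reindex[OF \<open>inj \<pi>\<close>])
    also have "\<dots> = measure Omega
        ((\<lambda>\<omega>. \<omega> \<circ> \<pi>) -` {\<omega> \<in> space Omega. decreasing \<omega> xs} \<inter> space Omega)"
      by (rule measure_distr[OF measurable_Omega_reindex sets_decreasing])
    also have "(\<lambda>\<omega>. \<omega> \<circ> \<pi>) -` {\<omega> \<in> space Omega. decreasing \<omega> xs} \<inter> space Omega = D \<pi>"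
      using measurable_space[OF measurable_Omega_reindex[of \<pi>]]
      by (auto simp: D_def decreasing_comp)
    finally show ?thesis ..
  qed
  have disj: "disjoint_family_on D perms"
  unfolding disjoint_family_on_def
  proof (intro ballI impI equals0I)
    fix \<pi> \<rho> \<omega> assume *: "\<pi> \<in> perms" "\<rho> \<in> perms" "\<pi> \<noteq> \<rho>" "\<omega> \<in> D \<pi> \<inter> D \<rho>"
    then have "map \<pi> xs = map \<rho> xs"
      by (intro decreasing_unique[of \<omega>]) (auto simp: D_def perms_def permutes_image)
    then have "\<pi> x = \<rho> x" for x
      using * by (cases "x \<in> set xs") (auto simp: perms_def permutes_not_in)
    with \<open>\<pi> \<noteq> \<rho>\<close> show False
      by auto
  qed
  have "fact (length xs) * measure Omega {\<omega> \<in> space Omega. decreasing \<omega> xs} =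
      (\<Sum>\<pi>\<in>perms. measure Omega (D \<pi>))"
    using D_eq card by simp
  also have "\<dots> = measure Omega (\<Union>\<pi>\<in>perms. D \<pi>)"
    by (rule Omega.finite_measure_finite_Union[OF fin _ disj, symmetric]) (auto simp: D_def)
  also have "\<dots> \<le> 1"
    by simp
  finally show ?thesis
    by (simp add: field_simps)
qed

lemma pred_descends [measurable]: "Measurable.pred Omega (descends \<nu> n x)"
  unfolding Omega_def
  by (rule measurable_order_local[OF _ _ same_order_descends]) auto

text \<open>
  The union bound over all paths with \<open>n\<close> steps: there are at most \<open>K ^ n\<close> of them, where \<open>K\<close> is the
  number of sites in a ball of radius \<open>\<nu>\<close>, and each has \<open>Suc n\<close> sites. The
  type argument carries the dimension, on which \<open>K\<close> depends.
\<close>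

definition descent_bound :: "nat \<Rightarrow> 'd::finite itself \<Rightarrow> nat \<Rightarrow> real"
  where "descent_bound \<nu> _ n = real (card (sup_ball \<nu> (0::'d site))) ^ n / fact (Suc n)"

lemma descent_bound_nonneg: "descent_bound \<nu> TYPE('d::finite) n \<ge> 0"
  by (simp add: descent_bound_def)

lemma prob_descends_le:
  fixes x :: "'d::finite site"
  shows "measure Omega {\<omega> \<in> space Omega. descends \<nu> n x \<omega>} \<le> descent_bound \<nu> TYPE('d) n"
proof -
  have "{\<omega> \<in> space Omega. descends \<nu> n x \<omega>} =
      (\<Union>xs\<in>paths \<nu> n x. {\<omega> \<in> space Omega. decreasing \<omega> xs})"
    by (auto simp: descends_def)
  then have "measure Omega {\<omega> \<in> space Omega. descends \<nu> n x \<omega>} \<le>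
      (\<Sum>xs\<in>paths \<nu> n x. measure Omega {\<omega> \<in> space Omega. decreasing \<omega> xs})"
    by (simp only:) (rule Omega.finite_measure_subadditive_finite; auto)
  also have "\<dots> \<le> (\<Sum>xs\<in>paths \<nu> n x. 1 / fact (Suc n))"
  proof (rule sum_mono)
    fix xs assume "xs \<in> paths \<nu> n x"
    then have "length xs = Suc n"
      by (simp add: paths_def)
    then show "measure Omega {\<omega> \<in> space Omega. decreasing \<omega> xs} \<le> 1 / fact (Suc n)"
      using prob_decreasing_le[of xs] by simp
  qed
  also have "\<dots> = real (card (paths \<nu> n x)) / fact (Suc n)"
    by simp
  also have "\<dots> \<le> real (card (sup_ball \<nu> (0::'d site)) ^ n) / fact (Suc n)"
    by (intro divide_right_mono of_nat_mono card_paths_le) simp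
  finally show ?thesis
    by (simp add: descent_bound_def)
qed

text \<open>
  The exponential factor can be absorbed into \<open>K\<close>, which leaves the general term of an
  exponential series.
\<close>

lemma descent_bound_superexponential:
  "(\<lambda>n. descent_bound \<nu> TYPE('d::finite) n * exp (\<beta> * real (Suc n))) \<longlonglongrightarrow> 0"
proof -
  define K where "K = real (card (sup_ball \<nu> (0::'d site)))"
  have "(\<lambda>n. inverse (fact n) * (K * exp \<beta>) ^ n) \<longlonglongrightarrow> 0"
    by (rule summable_LIMSEQ_zero[OF summable_exp])
  then have "(\<lambda>n. exp \<beta> * (inverse (fact n) * (K * exp \<beta>) ^ n)) \<longlonglongrightarrow> 0"
    by (rule tendsto_mult_right_zero)
  then show ?thesis
  proof (rule Lim_null_comparison[rotated])
    show "\<forall>\<^sub>F n in sequentially. norm (descent_bound \<nu> TYPE('d) n * exp (\<beta> * real (Suc n)))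
        \<le> exp \<beta> * (inverse (fact n) * (K * exp \<beta>) ^ n)"
    proof (intro always_eventually allI)
      fix n
      have exp: "exp (\<beta> * real (Suc n)) = exp \<beta> * exp \<beta> ^ n"
        by (simp add: algebra_simps exp_add flip: exp_of_nat_mult)
      have "descent_bound \<nu> TYPE('d) n \<le> K ^ n / fact n"
        unfolding descent_bound_def K_def
        by (intro divide_left_mono fact_mono) auto
      then have "descent_bound \<nu> TYPE('d) n * exp (\<beta> * real (Suc n)) \<le>
          K ^ n / fact n * (exp \<beta> * exp \<beta> ^ n)"
        unfolding exp by (rule mult_right_mono) simp
      also have "\<dots> = exp \<beta> * (inverse (fact n) * (K * exp \<beta>) ^ n)"
        by (simp add: field_simps power_mult_distrib)
      finally show "norm (descent_bound \<nu> TYPE('d) n * exp (\<beta> * real (Suc n)))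
          \<le> exp \<beta> * (inverse (fact n) * (K * exp \<beta>) ^ n)"
        by (simp only: real_norm_def abs_mult abs_of_nonneg[OF descent_bound_nonneg] abs_exp_cancel)
    qed
  qed
qed

lemma descent_bound_tendsto_0: "descent_bound \<nu> TYPE('d::finite) \<longlonglongrightarrow> 0"
  using descent_bound_superexponential[of \<nu> 0, where 'd = 'd] by simp

section \<open>The exceptional set is null\<close>

text \<open>
  Two clocks at different sites are independent, so by Fubini their coincidence has the
  probability of the diagonal of the square, whose sections are single points.
\<close>

lemma AE_clocks_neq:
  fixes a b :: "'d::finite site"
  assumes "a \<noteq> b"
  shows "AE \<omega> in Omega. \<omega> a \<noteq> \<omega> b"
proof -
  interpret clock: prob_space clock_law
    by (rule prob_space_clock_law)
  interpret clock_pair: pair_prob_space clock_law clock_law ..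
  have id: "(\<lambda>u. u) \<in> borel_measurable clock_law"
    by (simp add: measurable_restrict_space1)
  have [measurable]: "fst \<in> borel_measurable (clock_law \<Otimes>\<^sub>M clock_law)" "snd \<in> borel_measurable (clock_law \<Otimes>\<^sub>M clock_law)"
    using measurable_compose[OF measurable_fst id] measurable_compose[OF measurable_snd id] by auto
  have coord: "(\<lambda>\<omega>. \<omega> x) \<in> Omega \<rightarrow>\<^sub>M clock_law" for x :: "'d site"
    unfolding Omega_def by simp
  have distr: "distr Omega clock_law (\<lambda>\<omega>. \<omega> x) = clock_law" for x :: "'d site"
    unfolding Omega_def by (rule distr_PiM_component) (auto intro: prob_space_clock_law)
  have "Omega.indep_var clock_law ((\<lambda>\<omega>. \<omega> a) \<circ> (\<lambda>\<omega>. restrict \<omega> {a})) clock_law ((\<lambda>\<omega>. \<omega> b) \<circ> (\<lambda>\<omega>. restrict \<omega> {b}))"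
    by (rule Omega.indep_var_compose[OF Omega.indep_var_restrict[OF indep_clocks, of "{a}" "{b}"]])
      (use assms in auto)
  then have "Omega.indep_var clock_law (\<lambda>\<omega>. \<omega> a) clock_law (\<lambda>\<omega>. \<omega> b)"
    by (simp add: comp_def)
  then have pair: "clock_law \<Otimes>\<^sub>M clock_law = distr Omega (clock_law \<Otimes>\<^sub>M clock_law) (\<lambda>\<omega>. (\<omega> a, \<omega> b))"
    by (simp add: Omega.indep_var_distribution_eq distr)
  have sets: "{p \<in> space (clock_law \<Otimes>\<^sub>M clock_law). fst p \<noteq> snd p} \<in> sets (clock_law \<Otimes>\<^sub>M clock_law)"
    by measurable
  have "AE p in clock_law \<Otimes>\<^sub>M clock_law. fst p \<noteq> snd p"
  proof (rule clock_pair.AE_pair_measure[OF sets], rule AE_I2)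
    show "AE y in clock_law. fst (x, y) \<noteq> snd (x, y)" for x :: real
      using AE_clock_law_neq[of x] by (simp add: eq_commute)
  qed
  then have "AE p in distr Omega (clock_law \<Otimes>\<^sub>M clock_law) (\<lambda>\<omega>. (\<omega> a, \<omega> b)). fst p \<noteq> snd p"
    unfolding pair[symmetric] .
  then show ?thesis
    using AE_distr_iff[OF measurable_Pair[OF coord coord] sets] by simp
qed

text \<open>
  Coincidences of clocks are covered by countably many pairs of sites. Infinite descent from a
  given site implies descents of every length, whose probabilities tend to \<open>0\<close>.
\<close>

lemma AE_not_exceptional: "AE \<omega> in Omega. \<not> exceptional \<nu> (\<omega> :: 'd::finite clocks)"
proof -
  have "AE \<omega> in Omega. \<forall>a b. a \<noteq> b \<longrightarrow> \<omega> a \<noteq> (\<omega> :: 'd clocks) b"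
    by (simp add: AE_all_countable AE_clocks_neq)
  moreover have "AE \<omega> in Omega. \<forall>x. \<exists>n. \<not> descends \<nu> n x (\<omega> :: 'd clocks)"
    unfolding AE_all_countable
  proof
    fix x :: "'d site"
    define E where "E = {\<omega> \<in> space Omega. \<forall>n. descends \<nu> n x \<omega>}"
    have [measurable]: "E \<in> sets Omega"
      unfolding E_def by measurable
    have "measure Omega E \<le> descent_bound \<nu> TYPE('d) n" for n
      by (rule order.trans[OF Omega.finite_measure_mono prob_descends_le[of _ _ x]])
        (auto simp: E_def)
    then have "measure Omega E \<le> 0"
      by (intro LIMSEQ_le_const[OF descent_bound_tendsto_0]) blast
    then have "Omega.prob E = 0"
      by (simp add: measure_le_0_iff)
    then have "AE \<omega> in Omega. \<omega> \<notin> E"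
      by (subst (asm) Omega.prob_eq_0) auto
    then show "AE \<omega> in Omega. \<exists>n. \<not> descends \<nu> n x \<omega>"
      by (auto simp: E_def)
  qed
  ultimately show ?thesis
    by eventually_elim (auto simp: exceptional_iff inj_def)
qed

section \<open>Correlations of the limit algorithm\<close>

lemma measurable_local_limit:
  "(\<lambda>\<omega>. local_limit \<nu> S n \<omega> x) \<in> Omega \<rightarrow>\<^sub>M count_space UNIV"
  unfolding Omega_def
  by (rule measurable_order_local[of "sup_ball (n * \<nu>) x"]) (auto intro: same_order_local_limit)

text \<open>
  Outside the exceptional set some local limit gives the exact value. Choosing the least suitable
  radius expresses the limit algorithm through countably many local functions.
\<close>

lemma measurable_limit_algorithm:
  fixes x :: "'d::finite site"
  shows "(\<lambda>\<omega>. limit_algorithm \<nu> S \<omega> x) \<in> Omega \<rightarrow>\<^sub>M count_space UNIV"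
proof -
  have clock: "(\<lambda>\<omega>. \<omega> a) \<in> borel_measurable Omega" for a :: "'d site"
    unfolding Omega_def by (rule measurable_clock) simp
  have [measurable]: "Measurable.pred Omega (\<lambda>\<omega>. \<omega> a = \<omega> b)" for a b :: "'d site"
    unfolding pred_def by (rule borel_measurable_eq[OF clock clock])
  note [measurable] = measurable_local_limit
  have [measurable]: "(\<lambda>\<omega>. local_limit \<nu> S (LEAST n. \<not> descends \<nu> n x \<omega>) \<omega> x)
      \<in> Omega \<rightarrow>\<^sub>M count_space UNIV"
    by (rule measurable_compose_countable) measurable
  have "exceptional \<nu> =
      (\<lambda>\<omega> :: 'd clocks. (\<exists>a b. a \<noteq> b \<and> \<omega> a = \<omega> b) \<or> (\<exists>x. \<forall>n. descends \<nu> n x \<omega>))"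
    by (rule ext) (auto simp: exceptional_iff inj_def)
  moreover have "Measurable.pred Omega
      (\<lambda>\<omega> :: 'd clocks. (\<exists>a b. a \<noteq> b \<and> \<omega> a = \<omega> b) \<or> (\<exists>x. \<forall>n. descends \<nu> n x \<omega>))"
    by measurable
  ultimately have [measurable]: "Measurable.pred Omega (exceptional \<nu> :: 'd clocks \<Rightarrow> bool)"
    by simp
  have "limit_algorithm \<nu> S \<omega> x = (if exceptional \<nu> \<omega> then 0
      else local_limit \<nu> S (LEAST n. \<not> descends \<nu> n x \<omega>) \<omega> x)" for \<omega>
  proof (cases "exceptional \<nu> \<omega>")
    case False
    then have "\<exists>n. \<not> descends \<nu> n x \<omega>"
      by (auto simp: exceptional_iff)
    then have "\<not> descends \<nu> (LEAST n. \<not> descends \<nu> n x \<omega>) x \<omega>"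
      by (rule LeastI_ex)
    then show ?thesis
      using False limit_algorithm_eq_local_limit by auto
  qed (simp add: limit_algorithm_def)
  then show ?thesis
    by simp
qed

lemma expectation_limit_algorithm_translate:
  fixes h :: "nat \<Rightarrow> real"
  shows "(LINT \<omega>|Omega. h (limit_algorithm \<nu> S \<omega> x)) =
    (LINT \<omega>|Omega. h (limit_algorithm \<nu> S \<omega> (0 :: 'd::finite site)))"
proof -
  have m: "(\<lambda>\<omega>. h (limit_algorithm \<nu> S \<omega> (0 :: 'd site))) \<in> borel_measurable Omega"
    by (rule measurable_compose[OF measurable_limit_algorithm]) simp
  have "inj (\<lambda>z. z + x)"
    by (simp add: inj_def)
  then have "(LINT \<omega>|Omega. h (limit_algorithm \<nu> S \<omega> 0)) =
      (LINT \<omega>|distr Omega Omega (\<lambda>\<omega>. \<omega> \<circ> (\<lambda>z. z + x)). h (limit_algorithm \<nu> S \<omega> 0))"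
    by (simp add: distr_Omega_reindex)
  also have "\<dots> = (LINT \<omega>|Omega. h (limit_algorithm \<nu> S (\<omega> \<circ> (\<lambda>z. z + x)) 0))"
    by (rule integral_distr[OF measurable_Omega_reindex m])
  also have "\<dots> = (LINT \<omega>|Omega. h (limit_algorithm \<nu> S \<omega> x))"
    using limit_algorithm_translate[of \<nu> S x _ 0] by (simp add: shift_def comp_def)
  finally show ?thesis ..
qed

lemma (in prob_space) abs_expectation_diff_le:
  fixes X Y :: "'a \<Rightarrow> real"
  assumes meas: "X \<in> borel_measurable M" "Y \<in> borel_measurable M"
    and X: "\<And>\<omega>. X \<omega> \<in> {0..1}" and Y: "\<And>\<omega>. Y \<omega> \<in> {0..1}"
    and A: "A \<in> events" and eq: "AE \<omega> in M. \<omega> \<notin> A \<longrightarrow> X \<omega> = Y \<omega>"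
  shows "\<bar>expectation X - expectation Y\<bar> \<le> prob A"
proof -
  have int: "integrable M X" "integrable M Y"
    using X Y meas by (auto intro!: integrable_const_bound[of _ 1])
  have "\<bar>expectation X - expectation Y\<bar> = \<bar>expectation (\<lambda>\<omega>. X \<omega> - Y \<omega>)\<bar>"
    using int by simp
  also have "\<dots> \<le> expectation (\<lambda>\<omega>. \<bar>X \<omega> - Y \<omega>\<bar>)"
    by (rule integral_abs_bound)
  also have "\<dots> \<le> expectation (indicator A)"
  proof (rule integral_mono_AE)
    show "integrable M (indicator A :: 'a \<Rightarrow> real)"
      using A by (auto simp: emeasure_eq_measure)
    show "AE \<omega> in M. \<bar>X \<omega> - Y \<omega>\<bar> \<le> indicator A \<omega>"
      using eq
    proof eventually_elim
      case (elim \<omega>)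
      then show ?case
        using X[of \<omega>] Y[of \<omega>] by (auto simp: indicator_def abs_if)
    qed
  qed (use int in auto)
  finally show ?thesis
    using A by simp
qed

text \<open>
  Since all values lie in the unit interval, replacing \<open>X\<close> and \<open>Y\<close> by their approximations changes
  the expectation of the product and the product of the expectations by at most
  \<open>prob A + prob B\<close> each.
\<close>

lemma (in prob_space) covariance_le_of_indep_approx:
  fixes X Y X' Y' :: "'a \<Rightarrow> real"
  assumes meas [measurable]: "X \<in> borel_measurable M" "Y \<in> borel_measurable M"
      "X' \<in> borel_measurable M" "Y' \<in> borel_measurable M"
    and range: "\<And>\<omega>. X \<omega> \<in> {0..1}" "\<And>\<omega>. Y \<omega> \<in> {0..1}"
      "\<And>\<omega>. X' \<omega> \<in> {0..1}" "\<And>\<omega>. Y' \<omega> \<in> {0..1}"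
    and A: "A \<in> events" "AE \<omega> in M. \<omega> \<notin> A \<longrightarrow> X \<omega> = X' \<omega>"
    and B: "B \<in> events" "AE \<omega> in M. \<omega> \<notin> B \<longrightarrow> Y \<omega> = Y' \<omega>"
    and uncorrelated: "expectation (\<lambda>\<omega>. X' \<omega> * Y' \<omega>) = expectation X' * expectation Y'"
  shows "\<bar>covariance M X Y\<bar> \<le> 2 * (prob A + prob B)"
proof -
  have prod: "X \<omega> * Y \<omega> \<in> {0..1}" "X' \<omega> * Y' \<omega> \<in> {0..1}" for \<omega>
    using range[of \<omega>] by (auto intro: mult_le_one)
  have int: "integrable M X" "integrable M Y" "integrable M (\<lambda>\<omega>. X \<omega> * Y \<omega>)"
    using range prod by (auto intro!: integrable_const_bound[of _ 1])
  have E: "expectation Y \<in> {0..1}" "expectation X' \<in> {0..1}"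
    using range by (auto intro!: integral_nonneg integral_le_const integrable_const_bound[of _ 1])
  have "covariance M X Y = expectation (\<lambda>\<omega>. X \<omega> * Y \<omega> - expectation X * Y \<omega>
      - expectation Y * X \<omega> + expectation X * expectation Y)"
    unfolding covariance_def by (intro Bochner_Integration.integral_cong) (auto simp: algebra_simps)
  also have "\<dots> = expectation (\<lambda>\<omega>. X \<omega> * Y \<omega>) - expectation X * expectation Y"
    using int by (simp add: prob_space)
  finally have cov: "covariance M X Y = expectation (\<lambda>\<omega>. X \<omega> * Y \<omega>) - expectation X * expectation Y" .
  have "AE \<omega> in M. \<omega> \<notin> A \<union> B \<longrightarrow> X \<omega> * Y \<omega> = X' \<omega> * Y' \<omega>"
    using A(2) B(2) by eventually_elim auto
  then have "\<bar>expectation (\<lambda>\<omega>. X \<omega> * Y \<omega>) - expectation (\<lambda>\<omega>. X' \<omega> * Y' \<omega>)\<bar> \<le> prob (A \<union> B)"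
    using A(1) B(1) prod by (intro abs_expectation_diff_le) auto
  also have "\<dots> \<le> prob A + prob B"
    using A(1) B(1) by (rule measure_Un_le)
  finally have 1: "\<bar>expectation (\<lambda>\<omega>. X \<omega> * Y \<omega>) - expectation X' * expectation Y'\<bar> \<le> prob A + prob B"
    by (simp add: uncorrelated)
  have 2: "\<bar>expectation X - expectation X'\<bar> \<le> prob A" "\<bar>expectation Y - expectation Y'\<bar> \<le> prob B"
    by (rule abs_expectation_diff_le; use A B range in auto)+
  have "\<bar>expectation X * expectation Y - expectation X' * expectation Y'\<bar> =
      \<bar>(expectation X - expectation X') * expectation Y + expectation X' * (expectation Y - expectation Y')\<bar>"
    by (simp add: algebra_simps)
  also have "\<dots> \<le> \<bar>expectation X - expectation X'\<bar> * 1 + 1 * \<bar>expectation Y - expectation Y'\<bar>"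
    using E by (intro order.trans[OF abs_triangle_ineq] add_mono)
      (auto simp: abs_mult mult_left_le mult_left_le_one_le)
  also have "\<dots> \<le> prob A + prob B"
    using 2 by simp
  finally show ?thesis
    using 1 unfolding cov abs_le_iff by (simp add: algebra_simps)
qed

text \<open>
  The factor \<open>4\<close> counts the two sites and the two terms of the covariance. The local limits at \<open>x\<close>
  and \<open>y\<close> are uncorrelated because the balls on which they depend are disjoint.
\<close>

lemma covariance_limit_algorithm_le:
  fixes x y :: "'d::finite site"
  assumes far: "2 * int (n * \<nu>) < sup_norm (x - y)"
  shows "\<bar>covariance Omega (\<lambda>\<omega>. real (limit_algorithm \<nu> S \<omega> x)) (\<lambda>\<omega>. real (limit_algorithm \<nu> S \<omega> y))\<bar>
    \<le> 4 * descent_bound \<nu> TYPE('d) n"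
proof -
  define A where "A z = {\<omega> \<in> space Omega. descends \<nu> n z \<omega>}" for z :: "'d site"
  have [measurable]: "A z \<in> sets Omega" for z
    unfolding A_def by measurable
  note [measurable] = measurable_limit_algorithm measurable_local_limit
  have eq: "AE \<omega> in Omega. \<omega> \<notin> A z \<longrightarrow> real (limit_algorithm \<nu> S \<omega> z) = real (local_limit \<nu> S n \<omega> z)" for z
    using AE_not_exceptional[of \<nu>] AE_space
    by eventually_elim (auto simp: A_def limit_algorithm_eq_local_limit)
  have uncorrelated: "(LINT \<omega>|Omega. real (local_limit \<nu> S n \<omega> x) * real (local_limit \<nu> S n \<omega> y)) =
      (LINT \<omega>|Omega. real (local_limit \<nu> S n \<omega> x)) * (LINT \<omega>|Omega. real (local_limit \<nu> S n \<omega> y))"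
    by (rule expectation_mult_order_local[OF finite_sup_ball finite_sup_ball disjoint_sup_ball[OF far]])
      (erule same_order_local_limit | rule local_limit_le_1)+
  have "\<bar>covariance Omega (\<lambda>\<omega>. real (limit_algorithm \<nu> S \<omega> x)) (\<lambda>\<omega>. real (limit_algorithm \<nu> S \<omega> y))\<bar>
      \<le> 2 * (measure Omega (A x) + measure Omega (A y))"
    by (rule Omega.covariance_le_of_indep_approx[OF _ _ _ _ _ _ _ _ _ eq[of x] _ eq[of y] uncorrelated])
      (use limit_algorithm_le_1 local_limit_le_1 in auto)
  also have "\<dots> \<le> 2 * (descent_bound \<nu> TYPE('d) n + descent_bound \<nu> TYPE('d) n)"
    unfolding A_def by (intro mult_left_mono add_mono prob_descends_le) simp
  finally show ?thesis
    by simp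
qed

text \<open>
  The constant \<open>c\<close> is the inverse of the common variance. Since \<open>a / 0 = 0\<close>, this remains true in
  the degenerate case of zero variance, where \<open>c = 0\<close>.
\<close>

lemma site_correlation_0_eq:
  fixes S :: "'d::finite config set"
  obtains c where "\<And>x. site_correlation \<nu> S 0 x =
    covariance Omega (\<lambda>\<omega>. real (limit_algorithm \<nu> S \<omega> 0)) (\<lambda>\<omega>. real (limit_algorithm \<nu> S \<omega> x)) * c"
proof -
  define V where "V x = Omega.variance (\<lambda>\<omega>. real (limit_algorithm \<nu> S \<omega> x))" for x :: "'d site"
  have V: "V x = V 0" for x
    unfolding V_def expectation_limit_algorithm_translate[of real \<nu> S x]
    by (rule expectation_limit_algorithm_translate)
  have "site_correlation \<nu> S 0 x =
      covariance Omega (\<lambda>\<omega>. real (limit_algorithm \<nu> S \<omega> 0)) (\<lambda>\<omega>. real (limit_algorithm \<nu> S \<omega> x))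
      * (1 / (sqrt (V 0) * sqrt (V 0)))" for x
    unfolding site_correlation_def correlation_def V_def[symmetric] V[of x] by simp
  then show thesis
    by (rule that)
qed

theorem theorem5p1:
  fixes \<nu> :: nat and S :: "'d::finite config set"
  assumes "\<nu> \<ge> 1"
    and "parking_scheme \<nu> S"
  shows "\<forall>\<alpha>::real. \<alpha> > 0 \<longrightarrow>
    ((\<lambda>x. site_correlation \<nu> S 0 x * exp (\<alpha> * real_of_int (sup_norm x))) \<longlongrightarrow> 0)
      (filtercomap sup_norm at_top)"
proof (intro allI impI)
  fix \<alpha> :: real assume "\<alpha> > 0"
  obtain c where c: "\<And>x. site_correlation \<nu> S 0 x =
      covariance Omega (\<lambda>\<omega>. real (limit_algorithm \<nu> S \<omega> 0)) (\<lambda>\<omega>. real (limit_algorithm \<nu> S \<omega> x)) * c"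
    using site_correlation_0_eq[of \<nu> S] by blast
  \<comment> \<open>With this rate, \<open>\<alpha> * sup_norm x\<close> is at most \<open>\<beta> * Suc n\<close> by the choice of \<open>n\<close> below.\<close>
  define \<beta> where "\<beta> = \<alpha> * (2 * real \<nu>)"
  \<comment> \<open>The largest \<open>n\<close> for which the balls of radius \<open>n * \<nu>\<close> around \<open>0\<close> and a site of norm \<open>s\<close> are disjoint.\<close>
  define N where "N s = nat ((s - 1) div (2 * int \<nu>))" for s
  define b where "b n = 4 * \<bar>c\<bar> * (descent_bound \<nu> TYPE('d) n * exp (\<beta> * real (Suc n)))" for n
  have bound: "norm (site_correlation \<nu> S 0 x * exp (\<alpha> * real_of_int (sup_norm x))) \<le> b (N (sup_norm x))"
    if x: "sup_norm x \<ge> 1" for x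
  proof -
    define n where "n = N (sup_norm x)"
    have n: "int n = (sup_norm x - 1) div (2 * int \<nu>)"
      using x assms(1) by (simp add: n_def N_def pos_imp_zdiv_nonneg_iff)
    have split: "int n * (2 * int \<nu>) + (sup_norm x - 1) mod (2 * int \<nu>) = sup_norm x - 1"
      unfolding n by (rule div_mult_mod_eq)
    have "(sup_norm x - 1) mod (2 * int \<nu>) \<ge> 0" "(sup_norm x - 1) mod (2 * int \<nu>) < 2 * int \<nu>"
      using assms(1) by simp_all
    with split have lower: "int n * (2 * int \<nu>) < sup_norm x"
      and upper: "sup_norm x \<le> int (Suc n) * (2 * int \<nu>)"
      by (simp_all add: algebra_simps)
    have "2 * int (n * \<nu>) < sup_norm (0 - x)"
      using lower sup_norm_minus_commute[of 0 x] by (simp add: mult_ac)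
    then have cov: "\<bar>covariance Omega (\<lambda>\<omega>. real (limit_algorithm \<nu> S \<omega> 0))
        (\<lambda>\<omega>. real (limit_algorithm \<nu> S \<omega> x))\<bar> \<le> 4 * descent_bound \<nu> TYPE('d) n"
      by (rule covariance_limit_algorithm_le)
    have "real_of_int (sup_norm x) \<le> real_of_int (int (Suc n) * (2 * int \<nu>))"
      using upper by (simp only: of_int_le_iff)
    then have "\<alpha> * real_of_int (sup_norm x) \<le> \<beta> * real (Suc n)"
      using mult_left_mono[of "real_of_int (sup_norm x)" _ \<alpha>] \<open>\<alpha> > 0\<close>
      by (simp add: \<beta>_def mult_ac)
    then have exp: "exp (\<alpha> * real_of_int (sup_norm x)) \<le> exp (\<beta> * real (Suc n))"
      by simp
    have "norm (site_correlation \<nu> S 0 x * exp (\<alpha> * real_of_int (sup_norm x))) \<le>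
        (4 * descent_bound \<nu> TYPE('d) n * \<bar>c\<bar>) * exp (\<beta> * real (Suc n))"
      unfolding c real_norm_def abs_mult
      by (intro mult_mono cov) (use exp in \<open>auto simp: descent_bound_def\<close>)
    then show ?thesis
      by (simp add: b_def n_def mult_ac)
  qed
  have "filterlim (\<lambda>s. (s - 1) div (2 * int \<nu>)) at_top at_top"
    unfolding filterlim_at_top
  proof
    fix k :: int
    have "k \<le> (s - 1) div (2 * int \<nu>)" if "k * (2 * int \<nu>) + 1 \<le> s" for s
      using zdiv_mono1[of "k * (2 * int \<nu>)" "s - 1" "2 * int \<nu>"] that assms(1) by simp
    then show "\<forall>\<^sub>F s in at_top. k \<le> (s - 1) div (2 * int \<nu>)"
      unfolding eventually_at_top_linorder by blast
  qed
  then have "filterlim N sequentially at_top"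
    unfolding N_def by (rule filterlim_compose[OF filterlim_nat_sequentially])
  moreover have "b \<longlonglongrightarrow> 0"
    unfolding b_def by (intro tendsto_mult_right_zero descent_bound_superexponential)
  ultimately have "((\<lambda>s. b (N s)) \<longlongrightarrow> 0) at_top"
    by (rule filterlim_compose[rotated])
  then have "((\<lambda>x. b (N (sup_norm x))) \<longlongrightarrow> 0) (filtercomap sup_norm at_top)"
    by (rule filterlim_compose[OF _ filterlim_filtercomap])
  moreover have "\<forall>\<^sub>F x in filtercomap sup_norm at_top. 1 \<le> sup_norm (x :: 'd site)"
    by (rule eventually_filtercomapI) (rule eventually_ge_at_top)
  then have "\<forall>\<^sub>F x in filtercomap sup_norm at_top.
      norm (site_correlation \<nu> S 0 x * exp (\<alpha> * real_of_int (sup_norm x))) \<le> b (N (sup_norm x))"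
    by eventually_elim (rule bound)
  ultimately show "((\<lambda>x. site_correlation \<nu> S 0 x * exp (\<alpha> * real_of_int (sup_norm x))) \<longlongrightarrow> 0)
      (filtercomap sup_norm at_top)"
    by (rule Lim_null_comparison[rotated])
qed

end
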